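(* Let $U$ be a non-empty finite set and let $R\subseteq U\times U$ be a binary relation on $U$. If $R$ is reflexive, then for all $X\subseteq U$ and each $i\in\{s,\,p,\,p\wedge s,\,p\vee s\}$, $\underline{apr}_{i}(X)\subseteq X\subseteq\overline{apr}_{i}(X)$.
   Context: For $x\in U$ put $R_s(x)=\{y\in U\mid (x,y)\in R\}$, $R_p(x)=\{y\in U\mid (y,x)\in R\}$, $R_{p\wedge s}(x)=R_s(x)\cap R_p(x)$, $R_{p\vee s}(x)=R_s(x)\cup R_p(x)$. For $i\in\{s,p,p\wedge s,p\vee s\}$ and $X\subseteq U$, $\underline{apr}_i(X)=\{x\in U\mid R_i(x)\subseteq X\}$ and $\overline{apr}_i(X)=\{x\in U\mid R_i(x)\cap X\neq\emptyset\}$. *)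

theory Defs
  imports Main
begin

datatype nbh_kind = Succ | Pred | Pred_and_Succ | Pred_or_Succ

definition succ_nbh :: "'a set \<Rightarrow> 'a rel \<Rightarrow> 'a \<Rightarrow> 'a set" where
  "succ_nbh U R x = {y \<in> U. (x, y) \<in> R}"

definition pred_nbh :: "'a set \<Rightarrow> 'a rel \<Rightarrow> 'a \<Rightarrow> 'a set" where
  "pred_nbh U R x = {y \<in> U. (y, x) \<in> R}"

fun nbh :: "'a set \<Rightarrow> 'a rel \<Rightarrow> nbh_kind \<Rightarrow> 'a \<Rightarrow> 'a set" where
  "nbh U R Succ x = succ_nbh U R x"
| "nbh U R Pred x = pred_nbh U R x"
| "nbh U R Pred_and_Succ x = succ_nbh U R x \<inter> pred_nbh U R x"
| "nbh U R Pred_or_Succ x = succ_nbh U R x \<union> pred_nbh U R x"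

definition lower_apr :: "'a set \<Rightarrow> 'a rel \<Rightarrow> nbh_kind \<Rightarrow> 'a set \<Rightarrow> 'a set" where
  "lower_apr U R i X = {x \<in> U. nbh U R i x \<subseteq> X}"

definition upper_apr :: "'a set \<Rightarrow> 'a rel \<Rightarrow> nbh_kind \<Rightarrow> 'a set \<Rightarrow> 'a set" where
  "upper_apr U R i X = {x \<in> U. nbh U R i x \<inter> X \<noteq> {}}"

end

theory Submission
  imports Defs
begin

text \<open>Reflexivity puts each point x of U into its own neighbourhood of every kind
  (\<open>mem_nbh_self\<close>). So a neighbourhood contained in X forces x into X, and for x in X
  \<subseteq> U the point x itself witnesses that its neighbourhood meets X.\<close>

lemma mem_nbh_self:
  assumes "refl_on U R" and "x \<in> U"
  shows "x \<in> nbh U R i x"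
  \<comment> \<open>The single pair (x, x) serves both directions of R, so x is a successor and a
    predecessor of itself, which settles intersection and union too.\<close>
  using assms by (cases i) (auto simp: succ_nbh_def pred_nbh_def dest: refl_onD)

theorem proposition28:
  fixes U :: "'a set" and R :: "'a rel"
  assumes "finite U" and "U \<noteq> {}" and "R \<subseteq> U \<times> U"
    and "refl_on U R"
  shows "\<forall>X i. X \<subseteq> U \<longrightarrow> lower_apr U R i X \<subseteq> X \<and> X \<subseteq> upper_apr U R i X"
  using mem_nbh_self[OF \<open>refl_on U R\<close>]
  unfolding lower_apr_def upper_apr_def by blast

end
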